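(* The weak metric space $(\mathcal{T}(T^2),\delta)$ is a weak Finsler metric space, with corresponding weak norms given, under the identification $\mathcal{T}(T^2)=\mathbb{H}$, by $$\|v\|_\delta=\frac{|v|+\mathrm{Im}(v)}{2\,\mathrm{Im}(\zeta)}\qquad(\zeta\in\mathbb{H},\ v\in T_\zeta\mathbb{H}\cong\mathbb{C}).$$ That is, these are weak norms on the tangent spaces depending continuously on the point, and for all $\zeta_1,\zeta_2\in\mathbb{H}$, $\delta(\zeta_1,\zeta_2)$ equals the infimum of $\int_{a}^{b}\|\dot\gamma(t)\|_\delta\,dt$ over all piecewise $C^1$ paths $\gamma:[a,b]\to\mathbb{H}$ with $\gamma(a)=\zeta_1$ and $\gamma(b)=\zeta_2$.
   Context: $\mathbb{H}=\{z\in\mathbb{C}\mid \mathrm{Im}(z)>0\}$. The Teichmüller space $\mathcal{T}(T^2)$ of the torus is identified with $\mathbb{H}$ by associating to $\zeta\in\mathbb{H}$ the marked torus $\mathbb{C}/(\mathbb{Z}+\zeta\mathbb{Z})$ whose marking sends fixed generators $a,b$ of $\pi_1(T^2)$ to $1,\zeta$ respectively. The weak metric $\delta$ is $$\delta(\zeta_1,\zeta_2)=\log\sup_{x\in\mathbb{R}}\left|\frac{\zeta_2-x}{\zeta_1-x}\right| .$$ A weak metric is a nonnegative function on pairs of points, zero on the diagonal, satisfying the triangle inequality (not necessarily symmetric or separating). A weak norm on a finite-dimensional real vector space $V$ is a map $V\to[0,\infty)$, $v\mapsto\|v\|$, with $\|0\|=0$ and $\|v+v'\|\le\|v\|+\|v'\|$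 for all $v,v'\in V$. A weak metric on a smooth manifold $M$ is weak Finsler if $M$ carries a continuous field of weak norms on its tangent spaces such that the distance from one point to another equals the infimum of the lengths of piecewise $C^1$ paths going from the first to the second, the length being the integral of the weak norms of the tangent vectors. *)

theory Defs
  imports "HOL-Analysis.Analysis"
begin

section \<open>Weak metrics, weak norms and weak Finsler metrics\<close>

definition weak_metric_on :: "'a set \<Rightarrow> ('a \<Rightarrow> 'a \<Rightarrow> real) \<Rightarrow> bool" where
  "weak_metric_on M d \<longleftrightarrow>
     (\<forall>p\<in>M. \<forall>q\<in>M. 0 \<le> d p q) \<and>
     (\<forall>p\<in>M. d p p = 0) \<and>
     (\<forall>p\<in>M. \<forall>q\<in>M. \<forall>r\<in>M. d p r \<le> d p q + d q r)"

text \<open>No homogeneity is part of the notion of weak norm.\<close>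

definition weak_norm :: "('v::real_vector \<Rightarrow> real) \<Rightarrow> bool" where
  "weak_norm N \<longleftrightarrow>
     (\<forall>v. 0 \<le> N v) \<and> N 0 = 0 \<and> (\<forall>v w. N (v + w) \<le> N v + N w)"

text \<open>
  The manifolds considered are open subsets \<open>M\<close> of a Euclidean space \<open>'a\<close>, so that every
  tangent space is \<open>'a\<close> and the tangent bundle is \<open>M \<times> UNIV\<close>. A field of weak norms
  is given by \<open>F p v\<close>, the weak norm of the tangent vector \<open>v\<close> at \<open>p\<close>;
  its continuity is joint continuity on the tangent bundle.
\<close>

definition continuous_weak_norm_field :: "'a::euclidean_space set \<Rightarrow> ('a \<Rightarrow> 'a \<Rightarrow> real) \<Rightarrow> bool" where
  "continuous_weak_norm_field M F \<longleftrightarrow>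
     (\<forall>p\<in>M. weak_norm (F p)) \<and> continuous_on (M \<times> UNIV) (\<lambda>(p, v). F p v)"

definition C1_on_segment :: "(real \<Rightarrow> 'a::real_normed_vector) \<Rightarrow> real \<Rightarrow> real \<Rightarrow> bool" where
  "C1_on_segment \<gamma> c d \<longleftrightarrow>
     (\<exists>D. continuous_on {c..d} D \<and>
          (\<forall>t\<in>{c..d}. (\<gamma> has_vector_derivative D t) (at t within {c..d})))"

text \<open>
  Piecewise \<open>C\<^sup>1\<close> in the usual sense: \<open>C\<^sup>1\<close> up to the endpoints on each closed piece of a
  subdivision (continuity on \<open>{a..b}\<close> follows, as consecutive pieces share an endpoint).
  The library's \<^const>\<open>piecewise_C1_differentiable_on\<close> does not require one-sided limits of the
  derivative at the exceptional points, and so admits paths of infinite length, on which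
  the integral below would take the default value 0.
\<close>

definition piecewise_C1_path :: "'a::real_normed_vector set \<Rightarrow> real \<Rightarrow> real \<Rightarrow> (real \<Rightarrow> 'a) \<Rightarrow> bool" where
  "piecewise_C1_path M a b \<gamma> \<longleftrightarrow>
     a < b \<and> \<gamma> ` {a..b} \<subseteq> M \<and>
     (\<exists>(n::nat) t. t 0 = a \<and> t n = b \<and>
        (\<forall>i<n. t i < t (Suc i) \<and> C1_on_segment \<gamma> (t i) (t (Suc i))))"

text \<open>The unspecified value of the derivative at the finitely many corners is irrelevant here.\<close>

definition Finsler_length :: "('a \<Rightarrow> 'a \<Rightarrow> real) \<Rightarrow> real \<Rightarrow> real \<Rightarrow> (real \<Rightarrow> 'a::real_normed_vector) \<Rightarrow> real" where
  "Finsler_length F a b \<gamma> =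
     integral {a..b} (\<lambda>t. F (\<gamma> t) (vector_derivative \<gamma> (at t within {a..b})))"

text \<open>
  The infimum is taken in the extended reals, where it is \<open>\<infinity>\<close> if there are no paths
  from \<open>p\<close> to \<open>q\<close>.
\<close>

definition weak_Finsler_with ::
    "'a::euclidean_space set \<Rightarrow> ('a \<Rightarrow> 'a \<Rightarrow> real) \<Rightarrow> ('a \<Rightarrow> 'a \<Rightarrow> real) \<Rightarrow> bool" where
  "weak_Finsler_with M d F \<longleftrightarrow>
     open M \<and> weak_metric_on M d \<and> continuous_weak_norm_field M F \<and>
     (\<forall>p\<in>M. \<forall>q\<in>M. ereal (d p q) =
        (INF (a, b, \<gamma>) \<in> {(a, b, \<gamma>). piecewise_C1_path M a b \<gamma> \<and> \<gamma> a = p \<and> \<gamma> b = q}.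
           ereal (Finsler_length F a b \<gamma>)))"


section \<open>The weak metric on the Teichmueller space of the torus\<close>

text \<open>
  The Teichmueller space of the torus is identified with the upper half-plane: the point \<open>\<zeta>\<close>
  stands for the torus \<open>\<complex> / (\<int> + \<zeta>\<int>)\<close>, marked by sending the fixed generators of
  the fundamental group to \<open>1\<close> and \<open>\<zeta>\<close>.
\<close>

definition teich_torus :: "complex set" where
  "teich_torus = {\<zeta>. 0 < Im \<zeta>}"

definition teich_delta :: "complex \<Rightarrow> complex \<Rightarrow> real" where
  "teich_delta \<zeta>\<^sub>1 \<zeta>\<^sub>2 = ln (SUP x::real. cmod ((\<zeta>\<^sub>2 - of_real x) / (\<zeta>\<^sub>1 - of_real x)))"

text \<open>The supremum is a genuine one.\<close>

lemma bdd_above_teich_delta: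
  assumes "\<zeta>\<^sub>1 \<in> teich_torus"
  shows "bdd_above (range (\<lambda>x::real. cmod ((\<zeta>\<^sub>2 - of_real x) / (\<zeta>\<^sub>1 - of_real x))))"
proof (rule bdd_aboveI2)
  fix x :: real
  have pos: "0 < Im \<zeta>\<^sub>1" using assms by (simp add: teich_torus_def)
  have ge: "Im \<zeta>\<^sub>1 \<le> cmod (\<zeta>\<^sub>1 - of_real x)"
    using abs_Im_le_cmod[of "\<zeta>\<^sub>1 - of_real x"] by simp
  have ne: "\<zeta>\<^sub>1 - of_real x \<noteq> 0" using pos ge by auto
  have "(\<zeta>\<^sub>2 - of_real x) / (\<zeta>\<^sub>1 - of_real x) = 1 + (\<zeta>\<^sub>2 - \<zeta>\<^sub>1) / (\<zeta>\<^sub>1 - of_real x)"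
    using ne by (simp add: field_simps)
  then have "cmod ((\<zeta>\<^sub>2 - of_real x) / (\<zeta>\<^sub>1 - of_real x))
      \<le> 1 + cmod (\<zeta>\<^sub>2 - \<zeta>\<^sub>1) / cmod (\<zeta>\<^sub>1 - of_real x)"
    by (metis norm_divide norm_one norm_triangle_ineq)
  also have "\<dots> \<le> 1 + cmod (\<zeta>\<^sub>2 - \<zeta>\<^sub>1) / Im \<zeta>\<^sub>1"
    using pos ge by (intro add_left_mono frac_le) auto
  finally show "cmod ((\<zeta>\<^sub>2 - of_real x) / (\<zeta>\<^sub>1 - of_real x)) \<le> 1 + cmod (\<zeta>\<^sub>2 - \<zeta>\<^sub>1) / Im \<zeta>\<^sub>1" .
qed

end

theory Submission
  imports Defs
begin

text \<open>
  For real \<open>x\<close>, the function \<open>ln |\<zeta> - x|\<close> has derivative \<open>Re (v / (\<zeta> - x))\<close> in direction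
  \<open>v\<close>. As \<open>x\<close> runs over the reals, \<open>1 / (\<zeta> - x)\<close> runs over a circle with centre
  \<open>-\<i> / (2 Im \<zeta>)\<close> and radius \<open>1 / (2 Im \<zeta>)\<close> (minus the point 0), so the supremum over \<open>x\<close>
  of these derivatives is \<open>\<parallel>v\<parallel>\<close>. Integrating along a path gives \<open>\<delta> \<le> length\<close>.
  Conversely a hyperbolic geodesic leaving the boundary point \<open>x\<close> realises the
  bound for that \<open>x\<close> at every time, so its length is \<open>ln |(\<zeta>\<^sub>2 - x) / (\<zeta>\<^sub>1 - x)| \<le> \<delta>\<close>;
  on a descending vertical segment the weak norm vanishes.
\<close>

abbreviation delta_norm :: "complex \<Rightarrow> complex \<Rightarrow> real" where
  "delta_norm \<zeta> v \<equiv> (cmod v + Im v) / (2 * Im \<zeta>)"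

section \<open>The supremum behind \<open>teich_delta\<close>\<close>

lemma diff_of_real_nonzero:
  assumes "0 < Im z"
  shows "z - of_real x \<noteq> 0"
  using assms by (auto simp: complex_eq_iff)

lemma cmod_quotient_le_SUP:
  assumes "0 < Im z"
  shows "cmod ((w - of_real x) / (z - of_real x))
      \<le> (SUP x::real. cmod ((w - of_real x) / (z - of_real x)))"
  using assms by (intro cSUP_upper bdd_above_teich_delta) (auto simp: teich_torus_def)

text \<open>The quotient tends to 1 as \<open>x\<close> goes to infinity, so no upper bound is below
  1. This gives nonnegativity of the logarithm, and also the positivity of the supremum under which
  \<open>ln\<close> may be compared.\<close>

lemma one_le_SUP_cmod_quotient:
  assumes "0 < Im z"
  shows "1 \<le> (SUP x::real. cmod ((w - of_real x) / (z - of_real x)))"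
proof -
  have "filterlim (\<lambda>x::real. z - of_real x) at_infinity at_top"
    unfolding filterlim_at_infinity[OF order_refl] eventually_at_top_linorder
  proof (intro allI impI exI)
    fix r x :: real
    assume "Re z + r \<le> x"
    then show "r \<le> cmod (z - of_real x)"
      using abs_Re_le_cmod[of "z - of_real x"] by simp
  qed
  then have "((\<lambda>x::real. (w - z) / (z - of_real x)) \<longlongrightarrow> 0) at_top"
    by (rule tendsto_divide_0[OF tendsto_const])
  then have "((\<lambda>x::real. cmod (1 + (w - z) / (z - of_real x))) \<longlongrightarrow> cmod (1 + 0)) at_top"
    by (intro tendsto_intros)
  also have "(\<lambda>x::real. 1 + (w - z) / (z - of_real x)) = (\<lambda>x. (w - of_real x) / (z - of_real x))"
    using diff_of_real_nonzero[OF assms] by (auto simp: field_simps)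
  finally have "((\<lambda>x::real. cmod ((w - of_real x) / (z - of_real x))) \<longlongrightarrow> 1) at_top"
    by simp
  then show ?thesis
    by (rule tendsto_upperbound) (auto intro!: always_eventually cmod_quotient_le_SUP assms)
qed

lemma teich_delta_nonneg:
  assumes "0 < Im z"
  shows "0 \<le> teich_delta z w"
  unfolding teich_delta_def using one_le_SUP_cmod_quotient[OF assms, of w] by simp

lemma ln_cmod_diff_le_teich_delta:
  assumes "0 < Im z" "0 < Im w"
  shows "ln (cmod (w - of_real x)) - ln (cmod (z - of_real x)) \<le> teich_delta z w"
proof -
  have nz: "w - of_real x \<noteq> 0" "z - of_real x \<noteq> 0"
    using assms diff_of_real_nonzero by auto
  then have "ln (cmod (w - of_real x)) - ln (cmod (z - of_real x))
      = ln (cmod ((w - of_real x) / (z - of_real x)))"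
    by (simp add: norm_divide ln_div)
  also have "\<dots> \<le> teich_delta z w"
    unfolding teich_delta_def
    using nz one_le_SUP_cmod_quotient[OF assms(1), of w] cmod_quotient_le_SUP[OF assms(1), of w x]
    by (subst ln_le_cancel_iff) auto
  finally show ?thesis .
qed

text \<open>Taking \<open>exp\<close> turns a common bound on the differences into a bound on the
  quotients. With \<open>ln_cmod_diff_le_teich_delta\<close> this makes
  \<open>teich_delta z w\<close> the least upper bound over \<open>x\<close> of the differences of
  \<open>ln |\<zeta> - x|\<close>; from here on it is handled only through these two bounds and
  nonnegativity.\<close>

lemma teich_delta_le:
  assumes "0 < Im z" "0 < Im w"
    and "\<And>x. ln (cmod (w - of_real x)) - ln (cmod (z - of_real x)) \<le> L"
  shows "teich_delta z w \<le> L"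
proof -
  have "cmod ((w - of_real x) / (z - of_real x)) \<le> exp L" for x
  proof -
    have nz: "w - of_real x \<noteq> 0" "z - of_real x \<noteq> 0"
      using assms diff_of_real_nonzero by auto
    then have "ln (cmod ((w - of_real x) / (z - of_real x))) \<le> L"
      using assms(3)[of x] by (simp add: norm_divide ln_div)
    then have "exp (ln (cmod ((w - of_real x) / (z - of_real x)))) \<le> exp L"
      by simp
    with nz show ?thesis
      by simp
  qed
  then have "(SUP x::real. cmod ((w - of_real x) / (z - of_real x))) \<le> exp L"
    by (intro cSUP_least) auto
  then show ?thesis
    unfolding teich_delta_def using one_le_SUP_cmod_quotient[OF assms(1), of w]
    by (metis exp_gt_zero less_le_trans ln_exp ln_le_cancel_iff zero_less_one)
qed

section \<open>Axioms of the weak metric and of the field of weak norms\<close>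

lemma weak_metric_on_teich_delta: "weak_metric_on teich_torus teich_delta"
  unfolding weak_metric_on_def teich_torus_def
proof (intro conjI ballI; clarsimp)
  fix p q :: complex
  assume "0 < Im p"
  then show "0 \<le> teich_delta p q" by (rule teich_delta_nonneg)
next
  fix p :: complex
  assume p: "0 < Im p"
  have "teich_delta p p \<le> 0" by (rule teich_delta_le) (use p in auto)
  with teich_delta_nonneg[OF p, of p] show "teich_delta p p = 0" by simp
next
  fix p q r :: complex
  assume "0 < Im p" "0 < Im q" "0 < Im r"
  \<comment> \<open>For each fixed \<open>x\<close> the difference from \<open>p\<close> to
    \<open>r\<close> splits at \<open>q\<close> into two differences, each bounded by its own
    \<open>teich_delta\<close>.\<close>
  then show "teich_delta p r \<le> teich_delta p q + teich_delta q r"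
    using ln_cmod_diff_le_teich_delta[of p q] ln_cmod_diff_le_teich_delta[of q r]
    by (intro teich_delta_le) (smt (verit))+
qed

lemma continuous_weak_norm_field_delta_norm:
  "continuous_weak_norm_field teich_torus delta_norm"
proof -
  have "weak_norm (delta_norm p)" if "0 < Im p" for p
    unfolding weak_norm_def
  proof (intro conjI allI)
    fix v w :: complex
    show "0 \<le> delta_norm p v"
      using that abs_Im_le_cmod[of v] by simp
    show "delta_norm p (v + w) \<le> delta_norm p v + delta_norm p w"
      using that norm_triangle_ineq[of v w]
      by (simp add: add_divide_distrib[symmetric] divide_right_mono)
  qed simp
  moreover have "continuous_on (teich_torus \<times> UNIV) (\<lambda>(p, v). delta_norm p v)"
    unfolding case_prod_beta teich_torus_def by (intro continuous_intros) auto
  ultimately show ?thesis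
    by (simp add: continuous_weak_norm_field_def teich_torus_def)
qed

section \<open>Lower bound for the length of a path\<close>

text \<open>With \<open>u = z - x\<close>, the identity \<open>2 * \<i> * Im z = u - cnj u\<close>
  splits \<open>2 * Im z * (v / u)\<close> into \<open>v\<close> times the unimodular number
  \<open>\<i> * cnj u / u\<close>, whose real part is at most \<open>cmod v\<close>, and
  \<open>- \<i> * v\<close>, whose real part is \<open>Im v\<close>.\<close>

lemma Re_divide_le_delta_norm:
  assumes "0 < Im z"
  shows "Re (v / (z - of_real x)) \<le> delta_norm z v"
proof -
  define u where "u = z - of_real x"
  have u: "Im u = Im z" "u \<noteq> 0"
    using diff_of_real_nonzero[OF assms] by (simp_all add: u_def)
  have eq: "2 * Im z * (v / u) = v * (\<i> * cnj u / u) - \<i> * v"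
  proof -
    have "2 * \<i> * of_real (Im z) = u - cnj u"
      by (simp add: complex_eq_iff u)
    then have "2 * of_real (Im z) = - \<i> * (u - cnj u)"
      by (simp add: complex_eq_iff)
    then have "2 * of_real (Im z) * v = - \<i> * (u - cnj u) * v"
      by simp
    then show ?thesis
      using u(2) by (simp add: field_simps)
  qed
  have "2 * Im z * Re (v / u) = Re (2 * Im z * (v / u))"
    by (metis Re_complex_of_real of_real_mult of_real_numeral scaleR_conv_of_real scaleR_complex.sel(1))
  also have "\<dots> = Re (v * (\<i> * cnj u / u)) + Im v"
    unfolding eq by simp
  also have "Re (v * (\<i> * cnj u / u)) \<le> cmod (v * (\<i> * cnj u / u))"
    by (rule complex_Re_le_cmod)
  also have "cmod (v * (\<i> * cnj u / u)) = cmod v"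
    using u(2) by (simp add: norm_mult norm_divide)
  finally show ?thesis
    using assms by (simp add: u_def field_simps)
qed

lemma has_integral_Re_divide_path:
  fixes \<gamma> D :: "real \<Rightarrow> complex"
  assumes "c \<le> d"
    and "\<And>t. t \<in> {c..d} \<Longrightarrow> (\<gamma> has_vector_derivative D t) (at t within {c..d})"
    and "\<And>t. t \<in> {c..d} \<Longrightarrow> 0 < Im (\<gamma> t)"
  shows "((\<lambda>t. Re (D t / (\<gamma> t - of_real x))) has_integral
           ln (cmod (\<gamma> d - of_real x)) - ln (cmod (\<gamma> c - of_real x))) {c..d}"
proof -
  have "((\<lambda>t. ln (cmod (\<gamma> t - of_real x))) has_vector_derivative Re (D t / (\<gamma> t - of_real x)))
      (at t within {c..d})" if t: "t \<in> {c..d}" for t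
  proof -
    \<comment> \<open>Subtracting a real number keeps the path in the upper half-plane, away from
      the branch cut of \<open>Ln\<close>; so \<open>Re (Ln ...)\<close> is a differentiable form of
      \<open>ln (cmod ...)\<close> along the path.\<close>
    have notin: "\<gamma> t - of_real x \<notin> \<real>\<^sub>\<le>\<^sub>0"
      using assms(3)[OF t] by (auto simp: complex_nonpos_Reals_iff)
    have "((\<lambda>t. \<gamma> t - of_real x) has_vector_derivative D t) (at t within {c..d})"
      using assms(2)[OF t] by (auto intro!: derivative_eq_intros)
    then have "(Ln \<circ> (\<lambda>t. \<gamma> t - of_real x) has_vector_derivative D t * inverse (\<gamma> t - of_real x))
        (at t within {c..d})"
      by (rule field_vector_diff_chain_within)
        (use notin in \<open>auto intro: has_field_derivative_at_within has_field_derivative_Ln\<close>)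
    then have "((\<lambda>t. Re (Ln (\<gamma> t - of_real x))) has_vector_derivative Re (D t / (\<gamma> t - of_real x)))
        (at t within {c..d})"
      by (auto dest: bounded_linear.has_vector_derivative[OF bounded_linear_Re]
          simp: o_def divide_inverse)
    then show ?thesis
      by (rule has_vector_derivative_transform[OF t, rotated])
        (use diff_of_real_nonzero assms(3) in auto)
  qed
  then show ?thesis
    by (rule fundamental_theorem_of_calculus[OF assms(1)])
qed

text \<open>At an endpoint of a piece the path may have a corner, where the derivative within
  \<open>{a..b}\<close> need not be the one-sided \<open>D\<close>; altering the integrand at
  \<open>c\<close> and \<open>d\<close> does not affect the integral. Joint continuity of
  \<open>F\<close> makes the integrand with \<open>D\<close> continuous, hence the integral is not a
  default value.\<close>

lemma has_integral_Finsler_segment: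
  fixes \<gamma> D :: "real \<Rightarrow> 'a::euclidean_space"
  assumes F: "continuous_weak_norm_field M F"
    and sub: "{c..d} \<subseteq> {a..b}"
    and D: "continuous_on {c..d} D"
      "\<And>t. t \<in> {c..d} \<Longrightarrow> (\<gamma> has_vector_derivative D t) (at t within {c..d})"
    and M: "\<gamma> ` {c..d} \<subseteq> M"
  shows "((\<lambda>t. F (\<gamma> t) (vector_derivative \<gamma> (at t within {a..b}))) has_integral
           integral {c..d} (\<lambda>t. F (\<gamma> t) (D t))) {c..d}"
    and "(\<lambda>t. F (\<gamma> t) (D t)) integrable_on {c..d}"
proof -
  have cont: "continuous_on {c..d} \<gamma>"
    using D(2) has_vector_derivative_continuous
    unfolding continuous_on_eq_continuous_within by blast
  have "continuous_on (M \<times> UNIV) (\<lambda>(p, v). F p v)"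
    using F by (simp add: continuous_weak_norm_field_def)
  then have "continuous_on {c..d} ((\<lambda>(p, v). F p v) \<circ> (\<lambda>t. (\<gamma> t, D t)))"
    by (intro continuous_on_compose continuous_intros cont D(1))
      (use M in \<open>auto elim!: continuous_on_subset\<close>)
  then show int: "(\<lambda>t. F (\<gamma> t) (D t)) integrable_on {c..d}"
    by (simp add: o_def integrable_continuous_real)
  show "((\<lambda>t. F (\<gamma> t) (vector_derivative \<gamma> (at t within {a..b}))) has_integral
           integral {c..d} (\<lambda>t. F (\<gamma> t) (D t))) {c..d}"
  proof (rule has_integral_spike_finite[of "{c, d}"])
    fix t assume t: "t \<in> {c..d} - {c, d}"
    then have "c < t" "t < d" "a \<le> c" "d \<le> b"
      using sub by auto
    then have "at t within {c..d} = at t" "at t within {a..b} = at t"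
      by (auto intro!: at_within_Icc_at)
    then show "F (\<gamma> t) (vector_derivative \<gamma> (at t within {a..b})) = F (\<gamma> t) (D t)"
      using D(2)[of t] t by (simp add: vector_derivative_at)
  qed (use int in \<open>auto simp: integrable_integral\<close>)
qed

lemma ln_cmod_diff_le_Finsler_length:
  assumes "piecewise_C1_path teich_torus a b \<gamma>"
  shows "ln (cmod (\<gamma> b - of_real x)) - ln (cmod (\<gamma> a - of_real x))
      \<le> Finsler_length delta_norm a b \<gamma>"
proof -
  define g where "g t = delta_norm (\<gamma> t) (vector_derivative \<gamma> (at t within {a..b}))" for t
  define h where "h t = ln (cmod (\<gamma> t - of_real x))" for t
  obtain n t where im: "\<gamma> ` {a..b} \<subseteq> teich_torus" and t: "t 0 = a" "t n = b"
    and step: "\<And>i. i < n \<Longrightarrow> t i < t (Suc i)"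
    and seg: "\<And>i. i < n \<Longrightarrow> C1_on_segment \<gamma> (t i) (t (Suc i))"
    using assms unfolding piecewise_C1_path_def by blast
  have mono: "t i \<le> t j" if "i \<le> j" "j \<le> n" for i j
    using that by (induction j rule: dec_induct) (auto intro: order_trans[OF _ less_imp_le[OF step]])
  \<comment> \<open>Induction over the pieces of the subdivision. Integrability is carried along
    because adding the integrals of adjacent pieces requires it.\<close>
  have "g integrable_on {a..t i} \<and> h (t i) - h a \<le> integral {a..t i} g" if "i \<le> n" for i
    using that
  proof (induction i)
    case 0
    then show ?case by (simp add: t integrable_negligible)
  next
    case (Suc i)
    then have IH: "g integrable_on {a..t i}" "h (t i) - h a \<le> integral {a..t i} g"
      by auto
    have le: "a \<le> t i" "t i \<le> t (Suc i)" "t (Suc i) \<le> b"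
      using mono[of 0 i] mono[of i "Suc i"] mono[of "Suc i" n] Suc.prems t by auto
    obtain D where D: "continuous_on {t i..t (Suc i)} D"
      "\<And>s. s \<in> {t i..t (Suc i)} \<Longrightarrow>
         (\<gamma> has_vector_derivative D s) (at s within {t i..t (Suc i)})"
      using seg[of i] Suc.prems unfolding C1_on_segment_def by auto
    have M: "\<gamma> ` {t i..t (Suc i)} \<subseteq> teich_torus" and sub: "{t i..t (Suc i)} \<subseteq> {a..b}"
      using im le by auto
    then have pos: "0 < Im (\<gamma> s)" if "s \<in> {t i..t (Suc i)}" for s
      using that M by (auto simp: teich_torus_def image_subset_iff)
    note seg_int = has_integral_Finsler_segment
      [OF continuous_weak_norm_field_delta_norm sub D M]
    have g: "(g has_integral integral {t i..t (Suc i)} (\<lambda>s. delta_norm (\<gamma> s) (D s)))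
        {t i..t (Suc i)}"
      unfolding g_def by (rule seg_int)
    have "h (t (Suc i)) - h (t i) \<le> integral {t i..t (Suc i)} (\<lambda>s. delta_norm (\<gamma> s) (D s))"
      unfolding h_def
      by (rule has_integral_le[OF has_integral_Re_divide_path[OF le(2) D(2) pos]
            integrable_integral[OF seg_int(2)]])
        (auto intro!: Re_divide_le_delta_norm pos)
    then have "h (t (Suc i)) - h (t i) \<le> integral {t i..t (Suc i)} g"
      using integral_unique[OF g] by simp
    moreover have int: "g integrable_on {a..t (Suc i)}"
      using le IH(1) g by (blast intro: Henstock_Kurzweil_Integration.integrable_combine)
    ultimately show ?case
      using IH(2) Henstock_Kurzweil_Integration.integral_combine[OF le(1,2) int] by simp
  qed
  from this[of n] show ?thesis
    by (simp add: t Finsler_length_def h_def flip: g_def)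
qed

section \<open>Geodesics whose length does not exceed \<open>teich_delta\<close>\<close>

lemma piecewise_C1_path_if_C1:
  assumes "a < b" "\<gamma> ` {a..b} \<subseteq> M" "C1_on_segment \<gamma> a b"
  shows "piecewise_C1_path M a b \<gamma>"
  unfolding piecewise_C1_path_def
  using assms by (intro conjI exI[of _ 1] exI[of _ "\<lambda>i. if i = 0 then a else b"]) auto

lemma C1_path_length:
  fixes \<gamma> D :: "real \<Rightarrow> complex"
  assumes "a < b" "continuous_on {a..b} D"
    and "\<And>t. t \<in> {a..b} \<Longrightarrow> (\<gamma> has_vector_derivative D t) (at t within {a..b})"
    and "\<And>t. t \<in> {a..b} \<Longrightarrow> 0 < Im (\<gamma> t)"
  shows "piecewise_C1_path teich_torus a b \<gamma>"
    and "Finsler_length delta_norm a b \<gamma> = integral {a..b} (\<lambda>t. delta_norm (\<gamma> t) (D t))"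
proof -
  have im: "\<gamma> ` {a..b} \<subseteq> teich_torus"
    using assms(4) by (auto simp: teich_torus_def)
  show "piecewise_C1_path teich_torus a b \<gamma>"
    using assms im by (intro piecewise_C1_path_if_C1) (auto simp: C1_on_segment_def)
  show "Finsler_length delta_norm a b \<gamma> = integral {a..b} (\<lambda>t. delta_norm (\<gamma> t) (D t))"
    unfolding Finsler_length_def
    by (rule integral_unique, rule has_integral_Finsler_segment
        [OF continuous_weak_norm_field_delta_norm order_refl assms(2,3) im])
qed

text \<open>The equality case of the lower bound: if one fixed \<open>x\<close> attains
  \<open>Re_divide_le_delta_norm\<close> at every time, the length is the difference for that
  \<open>x\<close>, hence at most \<open>teich_delta\<close> of the endpoints.\<close>

lemma C1_path_length_eq_ln_cmod_diff:
  fixes \<gamma> D :: "real \<Rightarrow> complex"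
  assumes "a < b" "continuous_on {a..b} D"
    and "\<And>t. t \<in> {a..b} \<Longrightarrow> (\<gamma> has_vector_derivative D t) (at t within {a..b})"
    and "\<And>t. t \<in> {a..b} \<Longrightarrow> 0 < Im (\<gamma> t)"
    and "\<And>t. t \<in> {a..b} \<Longrightarrow> Re (D t / (\<gamma> t - of_real x)) = delta_norm (\<gamma> t) (D t)"
  shows "Finsler_length delta_norm a b \<gamma>
      = ln (cmod (\<gamma> b - of_real x)) - ln (cmod (\<gamma> a - of_real x))"
proof -
  have "((\<lambda>t. delta_norm (\<gamma> t) (D t)) has_integral
      ln (cmod (\<gamma> b - of_real x)) - ln (cmod (\<gamma> a - of_real x))) {a..b}"
    using assms
    by (intro has_integral_eq[OF _ has_integral_Re_divide_path[of a b \<gamma> D x]]) auto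
  then show ?thesis
    using C1_path_length(2)[of a b D \<gamma>] assms by (simp add: integral_unique)
qed

lemma ex_short_path_vertical:
  assumes z: "0 < Im z" and w: "0 < Im w" and eq: "Re z = Re w"
  shows "\<exists>a b \<gamma>. piecewise_C1_path teich_torus a b \<gamma> \<and> \<gamma> a = z \<and> \<gamma> b = w \<and>
           Finsler_length delta_norm a b \<gamma> \<le> teich_delta z w"
proof -
  define s where "s = Im w - Im z"
  define \<gamma> where "\<gamma> t = Complex (Re z) (Im z + t * s)" for t
  define D where "D = (\<lambda>t::real. Complex 0 s)"
  have ends: "\<gamma> 0 = z" "\<gamma> 1 = w"
    using eq by (auto simp: \<gamma>_def s_def complex_eq_iff)
  have cont: "continuous_on {0..1} D"
    by (simp add: D_def)
  have deriv: "(\<gamma> has_vector_derivative D t) (at t within {0..1})" for t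
    unfolding \<gamma>_def D_def has_vector_derivative_complex_iff
    by (auto intro!: derivative_eq_intros)
  have pos: "0 < Im (\<gamma> t)" if "t \<in> {0..1}" for t
  proof -
    have "Im (\<gamma> t) = (1 - t) * Im z + t * Im w"
      by (simp add: \<gamma>_def s_def algebra_simps)
    also have "\<dots> > 0"
      using that z w by (cases "t = 0") (auto intro: add_nonneg_pos)
    finally show ?thesis .
  qed
  note path = C1_path_length[OF zero_less_one cont deriv pos]
  have "Finsler_length delta_norm 0 1 \<gamma> \<le> teich_delta z w"
  proof (cases "0 \<le> s")
    case True
    \<comment> \<open>Going up, the boundary point is the foot \<open>Re z\<close> of the vertical
      line: \<open>\<gamma> t - Re z\<close> and \<open>D t\<close> are both purely imaginary, and
      both sides equal \<open>s / Im (\<gamma> t)\<close>. The constant path, with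
      \<open>s = 0\<close>, is included.\<close>
    have "Re (D t / (\<gamma> t - of_real (Re z))) = delta_norm (\<gamma> t) (D t)" for t
    proof -
      have "delta_norm (\<gamma> t) (D t) = s / Im (\<gamma> t)"
        using True by (simp add: D_def cmod_def)
      then show ?thesis
        by (simp add: D_def \<gamma>_def Re_divide power2_eq_square)
    qed
    then show ?thesis
      using C1_path_length_eq_ln_cmod_diff[OF zero_less_one cont deriv pos, of "Re z"] ends
        ln_cmod_diff_le_teich_delta[OF z w, of "Re z"] by simp
  next
    case False
    then have "delta_norm (\<gamma> t) (D t) = 0" for t
      by (simp add: D_def cmod_def)
    then have "Finsler_length delta_norm 0 1 \<gamma> = 0"
      by (simp only: path(2) integral_0)
    then show ?thesis
      using teich_delta_nonneg[OF z, of w] by simp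
  qed
  with path(1) ends show ?thesis by blast
qed

lemma ex_short_path_circle:
  assumes z: "0 < Im z" and w: "0 < Im w" and ne: "Re z \<noteq> Re w"
  shows "\<exists>a b \<gamma>. piecewise_C1_path teich_torus a b \<gamma> \<and> \<gamma> a = z \<and> \<gamma> b = w \<and>
           Finsler_length delta_norm a b \<gamma> \<le> teich_delta z w"
proof -
  \<comment> \<open>\<open>c\<close> and \<open>r\<close> are the centre and radius of the semicircle through \<open>z\<close> and \<open>w\<close> orthogonal
    to the real axis; with the orientation \<open>\<sigma>\<close> the arc leaves the boundary point \<open>c + \<sigma> r\<close>.\<close>
  define \<sigma> :: real where "\<sigma> = sgn (Re z - Re w)"
  define c where "c = ((cmod w)\<^sup>2 - (cmod z)\<^sup>2) / (2 * (Re w - Re z))"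
  define r where "r = cmod (z - of_real c)"
  \<comment> \<open>For \<open>u\<close> on the semicircle this is the angle at \<open>c\<close>
    from the ray through \<open>c + \<sigma> * r\<close> to the ray through \<open>u\<close>. The
    range of \<open>arccos\<close> suffices since the arc stays above the real axis.\<close>
  define \<theta> where "\<theta> u = arccos (\<sigma> * (Re u - c) / r)" for u
  define \<gamma> where "\<gamma> t = Complex (c + \<sigma> * r * cos t) (r * sin t)" for t
  define D where "D t = Complex (- \<sigma> * r * sin t) (r * cos t)" for t
  have \<sigma>: "\<sigma> * \<sigma> = 1" "\<sigma>\<^sup>2 = 1"
    using ne by (auto simp: \<sigma>_def sgn_if)
  have r: "0 < r"
    using diff_of_real_nonzero[OF z] by (simp add: r_def)
  have z_circle: "(Re z - c)\<^sup>2 + (Im z)\<^sup>2 = r\<^sup>2"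
    by (simp add: r_def cmod_power2)
  \<comment> \<open>This is the condition that \<open>c\<close> be equidistant from \<open>z\<close>
    and \<open>w\<close>; the quadratic terms in \<open>c\<close> cancel.\<close>
  have "2 * (Re w - Re z) * c = (Re w)\<^sup>2 + (Im w)\<^sup>2 - ((Re z)\<^sup>2 + (Im z)\<^sup>2)"
    using ne by (simp add: c_def cmod_power2)
  then have w_circle: "(Re w - c)\<^sup>2 + (Im w)\<^sup>2 = r\<^sup>2"
    using z_circle by (simp add: power2_eq_square algebra_simps)
  have angle: "\<bar>\<sigma> * (Re u - c) / r\<bar> < 1" "\<theta> u \<in> {0<..<pi}" "\<gamma> (\<theta> u) = u"
    if u: "0 < Im u" "(Re u - c)\<^sup>2 + (Im u)\<^sup>2 = r\<^sup>2" for u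
  proof -
    have "(\<sigma> * (Re u - c) / r)\<^sup>2 = (Re u - c)\<^sup>2 / r\<^sup>2"
      by (simp add: \<sigma> power_divide power_mult_distrib)
    also have "\<dots> = (r\<^sup>2 - (Im u)\<^sup>2) / r\<^sup>2"
      using u(2) by simp
    also have "\<dots> = 1 - (Im u / r)\<^sup>2"
      using r by (simp add: power_divide diff_divide_distrib)
    finally have sq: "(\<sigma> * (Re u - c) / r)\<^sup>2 = 1 - (Im u / r)\<^sup>2" .
    moreover have "1 - (Im u / r)\<^sup>2 < 1\<^sup>2"
      using u(1) r by simp
    ultimately show lt: "\<bar>\<sigma> * (Re u - c) / r\<bar> < 1"
      by (subst abs_square_less_1[symmetric]) simp
    then show "\<theta> u \<in> {0<..<pi}"
      unfolding \<theta>_def abs_less_iff using arccos_lt_bounded[of "\<sigma> * (Re u - c) / r"]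
      by (simp add: minus_less_iff)
    have "cos (\<theta> u) = \<sigma> * (Re u - c) / r"
      using lt unfolding \<theta>_def by (intro cos_arccos_abs) auto
    moreover have "sin (\<theta> u) = Im u / r"
      using lt sq u(1) r unfolding \<theta>_def by (simp add: sin_arccos_abs)
    ultimately show "\<gamma> (\<theta> u) = u"
      using r \<sigma> by (simp add: \<gamma>_def complex_eq_iff mult.assoc[symmetric])
  qed
  note z_angle = angle[OF z z_circle] and w_angle = angle[OF w w_circle]
  \<comment> \<open>The sign \<open>\<sigma>\<close> is chosen so that \<open>z\<close> precedes
    \<open>w\<close> on the arc; \<open>arccos\<close> is decreasing and reverses this
    inequality.\<close>
  have "\<sigma> * (Re w - c) / r < \<sigma> * (Re z - c) / r"
    using ne r by (auto simp: \<sigma>_def sgn_if divide_strict_right_mono)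
  then have less: "\<theta> z < \<theta> w"
    using z_angle(1) w_angle(1) unfolding \<theta>_def abs_less_iff
    by (intro arccos_less_arccos) linarith+
  have cont: "continuous_on {\<theta> z..\<theta> w} D"
    unfolding D_def Complex_eq by (intro continuous_intros)
  have deriv: "(\<gamma> has_vector_derivative D t) (at t within {\<theta> z..\<theta> w})" for t
    unfolding \<gamma>_def D_def has_vector_derivative_complex_iff
    by (auto intro!: derivative_eq_intros)
  have sin_pos: "0 < sin t" if "t \<in> {\<theta> z..\<theta> w}" for t
    using that z_angle(2) w_angle(2) by (intro sin_gt_zero) auto
  then have pos: "0 < Im (\<gamma> t)" if "t \<in> {\<theta> z..\<theta> w}" for t
    using that r by (simp add: \<gamma>_def)
  \<comment> \<open>Both sides equal \<open>cot (t / 2) / 2\<close>. The left one is computed as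
    \<open>num\<close> over \<open>den\<close>, the latter being the squared distance from
    \<open>\<gamma> t\<close> to the boundary point, and the two half-angle forms are matched by
    \<open>sin_sq\<close>.\<close>
  have "Re (D t / (\<gamma> t - of_real (c + \<sigma> * r))) = delta_norm (\<gamma> t) (D t)"
    if "t \<in> {\<theta> z..\<theta> w}" for t
  proof -
    have sin: "0 < sin t" and sin_sq: "sin t * sin t = 1 - cos t * cos t"
      using sin_pos[OF that] sin_squared_eq[of t] by (auto simp: power2_eq_square)
    then have cos: "cos t \<noteq> 1"
      by auto
    have "cmod (D t) = r"
      using r \<sigma> by (simp add: D_def cmod_def power_mult_distrib distrib_left[symmetric])
    then have rhs: "delta_norm (\<gamma> t) (D t) = (1 + cos t) / (2 * sin t)"
      using r sin by (simp add: D_def \<gamma>_def field_simps)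
    have num: "- \<sigma> * r * sin t * (\<sigma> * r * (cos t - 1)) + r * cos t * (r * sin t) = r\<^sup>2 * sin t"
      using \<sigma>(2) by algebra
    have den: "(\<sigma> * r * (cos t - 1))\<^sup>2 + (r * sin t)\<^sup>2 = r\<^sup>2 * (2 * (1 - cos t))"
      using \<sigma>(2) sin_sq by algebra
    have diff: "\<gamma> t - of_real (c + \<sigma> * r) = Complex (\<sigma> * r * (cos t - 1)) (r * sin t)"
      by (simp add: \<gamma>_def complex_eq_iff algebra_simps)
    have "Re (D t / (\<gamma> t - of_real (c + \<sigma> * r))) = r\<^sup>2 * sin t / (r\<^sup>2 * (2 * (1 - cos t)))"
      unfolding diff D_def Re_divide complex.sel num den ..
    also have "\<dots> = sin t / (2 * (1 - cos t))"
      using r by simp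
    also have "\<dots> = (1 + cos t) / (2 * sin t)"
      proof (subst frac_eq_eq)
      show "sin t * (2 * sin t) = (1 + cos t) * (2 * (1 - cos t))"
        using sin_sq by algebra
    qed (use sin cos in auto)
    finally show ?thesis by (simp only: rhs)
  qed
  then have "Finsler_length delta_norm (\<theta> z) (\<theta> w) \<gamma> \<le> teich_delta z w"
    using C1_path_length_eq_ln_cmod_diff[OF less cont deriv pos, of "c + \<sigma> * r"]
      z_angle(3) w_angle(3) ln_cmod_diff_le_teich_delta[OF z w, of "c + \<sigma> * r"] by simp
  moreover have "piecewise_C1_path teich_torus (\<theta> z) (\<theta> w) \<gamma>"
    by (rule C1_path_length(1)[OF less cont deriv pos])
  ultimately show ?thesis
    using z_angle(3) w_angle(3) by blast
qed

section \<open>The distance as an infimum of lengths\<close>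

theorem corollary3p1:
  shows "weak_Finsler_with teich_torus teich_delta
           (\<lambda>\<zeta> v. (cmod v + Im v) / (2 * Im \<zeta>))"
proof -
  have "ereal (teich_delta p q) =
      (INF (a, b, \<gamma>) \<in> {(a, b, \<gamma>). piecewise_C1_path teich_torus a b \<gamma> \<and> \<gamma> a = p \<and> \<gamma> b = q}.
         ereal (Finsler_length delta_norm a b \<gamma>))" (is "_ = ?INF")
    if "p \<in> teich_torus" "q \<in> teich_torus" for p q
  proof (rule antisym)
    have pq: "0 < Im p" "0 < Im q"
      using that by (auto simp: teich_torus_def)
    show "ereal (teich_delta p q) \<le> ?INF"
      \<comment> \<open>A single path bounds the differences for all \<open>x\<close> at once, hence
        also their supremum.\<close>
      using pq by (auto intro!: INF_greatest teich_delta_le ln_cmod_diff_le_Finsler_length)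
    obtain a b \<gamma> where "piecewise_C1_path teich_torus a b \<gamma>" "\<gamma> a = p" "\<gamma> b = q"
      and le: "Finsler_length delta_norm a b \<gamma> \<le> teich_delta p q"
      \<comment> \<open>The infimum is attained. The case \<open>p = q\<close> falls under the
        vertical segments.\<close>
      using ex_short_path_vertical[OF pq] ex_short_path_circle[OF pq] by blast
    then have "?INF \<le> ereal (Finsler_length delta_norm a b \<gamma>)"
      by (intro INF_lower2[of "(a, b, \<gamma>)"]) auto
    also have "\<dots> \<le> ereal (teich_delta p q)"
      using le by simp
    finally show "?INF \<le> ereal (teich_delta p q)" .
  qed
  moreover have "open teich_torus"
    unfolding teich_torus_def by (rule open_halfspace_Im_gt)
  ultimately show ?thesis
    unfolding weak_Finsler_with_def
    using weak_metric_on_teich_delta continuous_weak_norm_field_delta_norm by blast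
qed

end
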